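(* Let $X$ be a positive componentwise solution of the system $$X_0(t)=0,\qquad \dot{X}_n(t)=k_{n-1}X_{n-1}^2(t)-k_nX_n(t)X_{n+1}(t)\quad (t\ge 0,\ n\ge 1),\qquad k_n=2^n,$$ with $X(0)=X^0\in l^{\infty}\cap\mathbb{R}_{+}^{\mathbb{N}}$. Let $n_0+1$ (with $n_0\ge0$) be the minimum integer with the property $X^0_{n_0+1}>0$ (so $X^0$ is assumed not identically zero). Then $X_n(t)>0$ for all $n>n_0$ and $t>0$, and, for some constant $C>0$, for every $n>n_0$ and every $t\ge1$ we have $$\int_1^tX_{n+1}(s)\,ds\ \ge\ k_n^{-1}\log t+k_n^{-1}\log\left(\frac{X_n(1)}{C}\right).$$ Thus, in particular, for every $n>n_0$, $$\int_1^\infty X_{n+1}(s)\,ds=\infty\qquad\text{and}\qquad \limsup_{t\to\infty}\ t\,X_{n+1}(t)\ge k_n^{-1}.$$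
   Context: $\mathbb{R}_+^{\mathbb{N}}$ is the set of sequences $(x_n)_{n\ge1}$ of non-negative real numbers; $l^\infty$ is the space of bounded real sequences. A componentwise solution with initial condition $X^0\in\mathbb{R}^{\mathbb{N}}$ is a sequence $X=(X_n(\cdot))_{n\ge1}$ of continuously differentiable functions $X_n:[0,\infty)\to\mathbb{R}$ with $X_n(0)=X^0_n$ for all $n\ge1$, satisfying all equations of the system. It is positive if $X_n(t)\ge0$ for all $n\ge1$, $t\ge0$. *)

theory Defs
  imports "HOL-Analysis.Analysis"
begin

definition kcoef :: "nat \<Rightarrow> real"
  where "kcoef n = 2 ^ n"

(* Sequences indexed by n >= 1 are functions on nat whose value at 0 is irrelevant. *)

definition bounded_seqs :: "(nat \<Rightarrow> real) set"
  where "bounded_seqs = {x. bounded (x ` {1..})}"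

definition nonneg_seqs :: "(nat \<Rightarrow> real) set"
  where "nonneg_seqs = {x. \<forall>n\<ge>1. 0 \<le> x n}"

(* The component X 0 is the boundary convention of the system, not an unknown.
   Only the values X n t with t >= 0 matter; the derivative at t = 0 is one-sided. *)
definition componentwise_solution :: "(nat \<Rightarrow> real) \<Rightarrow> (nat \<Rightarrow> real \<Rightarrow> real) \<Rightarrow> bool"
  where "componentwise_solution X0 X \<longleftrightarrow>
    (\<forall>t\<ge>0. X 0 t = 0) \<and>
    (\<forall>n\<ge>1. X n 0 = X0 n \<and>
      (\<exists>D. continuous_on {0..} D \<and>
        (\<forall>t\<ge>0. (X n has_real_derivative D t) (at t within {0..}) \<and>
          D t = kcoef (n - 1) * (X (n - 1) t)\<^sup>2 - kcoef n * X n t * X (n + 1) t)))"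

definition positive_solution :: "(nat \<Rightarrow> real \<Rightarrow> real) \<Rightarrow> bool"
  where "positive_solution X \<longleftrightarrow> (\<forall>n\<ge>1. \<forall>t\<ge>0. 0 \<le> X n t)"

end

theory Submission
  imports Defs
begin

text \<open>
  Everything rests on the decay $X_n(t) \le C/t$ for $t \ge 1$ with $C$ independent of $n$:
  inserted into $X_n(1) \le X_n(t) \exp(k_n \int_1^t X_{n+1})$ it gives the logarithmic bound, and
  from that the last two claims follow by real analysis.

  For the decay, let $E_n = \sum_{j \le n} X_j^2$, so that $E_n' = -2 k_n X_n^2 X_{n+1}$, and suppose
  $E_n(s) \le A (5/4)^n$ for all $n$. The product $X_n X_{n+1}$ has $k_n X_n^3$ as its main production
  term, and the loss terms are absorbed by the energy dissipation and by a small multiple of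
  $X_n^3 + X_{n+1}^3 + X_{n+2}^3$. Hence $\int_s^t X_n^3$ is at most $12 A (5/8)^n$ for every $t$.
  The geometric decay in $n$ allows to pass from cubes to squares and bounds the time average of $E_N$,
  hence $E_N$ at the later time, uniformly in $N$. Starting at time $0$, where bounded data give
  $E_n(0) \le n M^2$, this yields a finite energy at time $1$; applied on $[t/2, t]$ it propagates
  $t^2 E_N(t) \le K$ along doubling of $t$.
\<close>

section \<open>Elementary inequalities and a geometric recursion\<close>

text \<open>Derivatives within the interval are the right hypothesis, because the system provides
  only a one-sided derivative at time 0.\<close>

lemma increasing_within:
  fixes f :: "real \<Rightarrow> real"
  assumes "\<And>x. x \<in> {s..t} \<Longrightarrow> (f has_real_derivative f' x) (at x within {s..t})"
    and "\<And>x. x \<in> {s..t} \<Longrightarrow> 0 \<le> f' x" and "s \<le> t"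
  shows "f s \<le> f t"
proof -
  have "(f' has_integral f t - f s) {s..t}"
    using assms by (intro fundamental_theorem_of_calculus)
      (auto simp: has_real_derivative_iff_has_vector_derivative[symmetric])
  then have "0 \<le> f t - f s"
    by (rule has_integral_nonneg) (use assms in auto)
  then show ?thesis by simp
qed

text \<open>Each use of the recursion shrinks the a priori growth term by a fixed factor, so that
  term vanishes in the limit and \<open>B\<close> drops out of the bound. The factor 2 survives each
  use because 1 + 2 * (5/8 + 25/64) / 7 <= 2.\<close>

lemma le_geometric_of_recursion:
  fixes J :: "nat \<Rightarrow> real"
  assumes rec: "\<And>n. n \<ge> 1 \<Longrightarrow> J n \<le> a * (5/8)^n + (J (n+1) + J (n+2)) / 7"
    and growth: "\<And>n. n \<ge> 1 \<Longrightarrow> J n \<le> B * (25/16)^n"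
    and "0 \<le> a" "0 \<le> B" "n \<ge> 1"
  shows "J n \<le> 2 * a * (5/8)^n"
proof -
  \<comment> \<open>The rate $3/5$ comes from $((25/16) + (25/16)^2)/7 < 3/5$.\<close>
  have iter: "J n \<le> 2 * a * (5/8)^n + B * (25/16)^n * (3/5)^m" if "n \<ge> 1" for m n
    using that
  proof (induction m arbitrary: n)
    case 0
    have "0 \<le> 2 * a * (5/8)^n" using \<open>0 \<le> a\<close> by simp
    then show ?case using growth[OF 0] by simp
  next
    case (Suc m)
    define u v where "u = a * (5/8)^n" and "v = B * (25/16)^n * (3/5)^m"
    have nn: "0 \<le> u" "0 \<le> v" using assms by (auto simp: u_def v_def)
    have "J (n+1) \<le> 2 * u * (5/8) + v * (25/16)"
      using Suc.IH[of "n+1"] by (simp add: u_def v_def algebra_simps)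
    moreover have "J (n+2) \<le> 2 * u * (25/64) + v * (625/256)"
      using Suc.IH[of "n+2"] by (simp add: u_def v_def algebra_simps power2_eq_square)
    moreover have "J n \<le> u + (J (n+1) + J (n+2)) / 7"
      using rec[OF Suc.prems] by (simp add: u_def)
    ultimately have "J n \<le> 2 * u + v * (3/5)" using nn by (simp add: field_simps)
    then show ?case by (simp add: u_def v_def)
  qed
  have "(\<lambda>m. 2 * a * (5/8)^n + B * (25/16)^n * (3/5)^m) \<longlonglongrightarrow> 2 * a * (5/8)^n + B * (25/16)^n * (0::real)"
    by (intro tendsto_intros) auto
  then show ?thesis
    using iter[OF \<open>n \<ge> 1\<close>] by (intro LIMSEQ_le_const[of _ "2 * a * (5/8)^n"]) auto
qed

lemma sum_power_le:
  fixes r :: real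
  assumes "0 \<le> r" "r < 1"
  shows "(\<Sum>j=1..n. r ^ j) \<le> r / (1 - r)"
proof -
  have "(\<Sum>j=1..n. r ^ j) \<le> (\<Sum>j\<le>n. r ^ j) - 1"
    by (simp add: atMost_atLeast0 sum.atLeast_Suc_atMost)
  also have "(\<Sum>j\<le>n. r ^ j) \<le> 1 / (1 - r)"
    using assms by (simp add: lessThan_Suc_atMost[symmetric] sum_gp_strict divide_simps mult_left_le)
  finally show ?thesis using assms by (simp add: field_simps)
qed

text \<open>Young's inequality with exponents 3/2 and 3; the product in the proof expands to 2 x^3 -
  3 \<theta> x^2 + \<theta>^3.\<close>

lemma square_le_cube:
  fixes x \<theta> :: real
  assumes "0 \<le> x" "0 < \<theta>"
  shows "x\<^sup>2 \<le> 2/3 * x^3 / \<theta> + \<theta>\<^sup>2 / 3"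
proof -
  have "0 \<le> (x - \<theta>)\<^sup>2 * (2 * x + \<theta>)" using assms by (intro mult_nonneg_nonneg) auto
  then show ?thesis using assms
    by (simp add: field_simps power2_eq_square power3_eq_cube)
qed

section \<open>The positive dyadic system and its truncated energies\<close>

text \<open>Initial values enter only later, as hypotheses of \<open>energy_inverse_square\<close>
  and \<open>pos_after\<close>, so the estimates can be restarted at any time s.\<close>

locale dyadic_positive =
  fixes X :: "nat \<Rightarrow> real \<Rightarrow> real"
  assumes boundary: "0 \<le> t \<Longrightarrow> X 0 t = 0"
    and deriv: "\<lbrakk>1 \<le> n; 0 \<le> t\<rbrakk> \<Longrightarrow> (X n has_real_derivative
        kcoef (n - 1) * (X (n - 1) t)\<^sup>2 - kcoef n * X n t * X (n + 1) t) (at t within {0..})"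
    and nonneg: "0 \<le> t \<Longrightarrow> 0 \<le> X n t"
begin

lemma continuous: "0 \<le> s \<Longrightarrow> continuous_on {s..t} (X n)"
proof (cases "n = 0")
  case False
  assume "0 \<le> s"
  have "continuous_on {0..} (X n)"
    using deriv[of n] False by (auto intro!: DERIV_continuous_on)
  then show ?thesis by (rule continuous_on_subset) (use \<open>0 \<le> s\<close> in auto)
next
  case True
  assume "0 \<le> s"
  then have "continuous_on {s..t} (X 0) = continuous_on {s..t} (\<lambda>_. 0::real)"
    by (intro continuous_on_cong) (auto simp: boundary)
  then show ?thesis using True by simp
qed

definition energy :: "nat \<Rightarrow> real \<Rightarrow> real"
  where "energy n t = (\<Sum>j=1..n. (X j t)\<^sup>2)"

text \<open>The sum telescopes: what component j gains from component j - 1 is exactly what that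
  component loses. Only the flux out of component n remains, since nothing enters from
  \<open>X 0\<close>.\<close>

lemma energy_deriv:
  assumes "0 \<le> t"
  shows "(energy n has_real_derivative - 2 * kcoef n * (X n t)\<^sup>2 * X (n + 1) t) (at t within {0..})"
proof (induction n)
  case 0
  show ?case using assms by (simp add: energy_def[abs_def] boundary)
next
  case (Suc n)
  have "energy (Suc n) = (\<lambda>t. energy n t + (X (Suc n) t)\<^sup>2)"
    by (simp add: energy_def fun_eq_iff)
  moreover have "(\<dots> has_real_derivative - 2 * kcoef (Suc n) * (X (Suc n) t)\<^sup>2 * X (Suc n + 1) t) (at t within {0..})"
    using deriv[of "Suc n" t] assms
    by (auto intro!: derivative_eq_intros Suc.IH simp: algebra_simps power2_eq_square)
  ultimately show ?case by simp
qed

lemma energy_antimono: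
  assumes "0 \<le> s" "s \<le> t"
  shows "energy n t \<le> energy n s"
proof -
  have "- energy n s \<le> - energy n t"
  proof (rule increasing_within[where f = "\<lambda>t. - energy n t"])
    fix x assume "x \<in> {s..t}"
    then have "0 \<le> x" using assms by simp
    show "((\<lambda>t. - energy n t) has_real_derivative 2 * kcoef n * (X n x)\<^sup>2 * X (n + 1) x) (at x within {s..t})"
      using DERIV_subset[OF energy_deriv[OF \<open>0 \<le> x\<close>], of "{s..t}" n] assms
      by (auto intro!: derivative_eq_intros)
    show "0 \<le> 2 * kcoef n * (X n x)\<^sup>2 * X (n + 1) x"
      using \<open>0 \<le> x\<close> by (simp add: kcoef_def nonneg)
  qed (use assms in auto)
  then show ?thesis by simp
qed

lemma square_le_energy: "1 \<le> n \<Longrightarrow> (X n t)\<^sup>2 \<le> energy n t"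
  unfolding energy_def by (rule member_le_sum) auto

lemma energy_nonneg: "0 \<le> energy n t"
  unfolding energy_def by (intro sum_nonneg) auto

lemma integrable_cube: "0 \<le> s \<Longrightarrow> (\<lambda>x. (X n x)^3) integrable_on {s..t}"
  by (intro integrable_continuous_real continuous_intros continuous)

section \<open>Geometric decay in n of the time integrals of the cubes\<close>

lemma cube_integral_rec:
  assumes "0 \<le> s" "s \<le> t" "1 \<le> n" and A: "\<And>n. energy n s \<le> A * (5/4)^n"
  defines "J \<equiv> (\<lambda>n. integral {s..t} (\<lambda>x. (X n x)^3))"
  shows "J n \<le> 6 * A * (5/8)^n + (J (n+1) + J (n+2)) / 7"
proof -
  \<comment> \<open>The energies are weighted so that their dissipation dominates the loss terms of the product.\<close>
  define H where "H = (\<lambda>x. X n x * X (n+1) x - energy n x - 2 * energy (n+1) x)"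
  define H' where "H' = (\<lambda>x. 
     (kcoef (n - 1) * (X (n - 1) x)\<^sup>2 - kcoef n * X n x * X (n + 1) x) * X (n+1) x
     + X n x * (kcoef n * (X n x)\<^sup>2 - kcoef (n+1) * X (n+1) x * X (n + 2) x)
     + 2 * kcoef n * (X n x)\<^sup>2 * X (n + 1) x
     + 4 * kcoef (n+1) * (X (n+1) x)\<^sup>2 * X (n + 2) x)"
  have "(H has_real_derivative H' x) (at x within {s..t})" if "x \<in> {s..t}" for x
  proof -
    have "0 \<le> x" using that assms by simp
    have "(H has_real_derivative H' x) (at x within {0..})"
      unfolding H_def H'_def
      using deriv[of n x] deriv[of "n+1" x] \<open>0 \<le> x\<close> \<open>1 \<le> n\<close>
        energy_deriv[of x n] energy_deriv[of x "n+1"]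
      by (auto intro!: derivative_eq_intros simp: algebra_simps)
    then show ?thesis by (rule DERIV_subset) (use assms in auto)
  qed
  then have FTC: "(H' has_integral H t - H s) {s..t}"
    using assms by (intro fundamental_theorem_of_calculus)
      (auto simp: has_real_derivative_iff_has_vector_derivative[symmetric])
  have I: "((\<lambda>x. (X m x)^3) has_integral J m) {s..t}" for m
    unfolding J_def using integrable_cube[OF \<open>0 \<le> s\<close>] by (rule integrable_integral)
  have pointwise: "kcoef n * (X n x)^3 \<le>
      H' x + kcoef n * (((X n x)^3 + (X (n+1) x)^3 + (X (n+2) x)^3) * (1/8))"
    if "x \<in> {s..t}" for x
  proof -
    have "0 \<le> x" using that assms by simp
    define a b c where "a = X n x" and "b = X (n+1) x" and "c = X (n+2) x"
    have nn: "0 \<le> a" "0 \<le> b" "0 \<le> c"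
      using nonneg[OF \<open>0 \<le> x\<close>] by (auto simp: a_def b_def c_def)
    \<comment> \<open>Divided by 8, the squares give a b^2 <= b^3/8 + 2 a^2 b and 2 a b c <= 8 b^2 c
      + a^2 c/8. These are the two loss terms against the two dissipation terms; the remainder a^2
      c/8 goes into the cubes.\<close>
    have "0 \<le> b * (b - 4 * a)\<^sup>2" "0 \<le> c * (a - 8 * b)\<^sup>2" using nn by auto
    moreover have "a\<^sup>2 * c \<le> a^3 + c^3"
    proof (cases "a \<le> c")
      case True
      then have "a\<^sup>2 * c \<le> c\<^sup>2 * c" using nn by (intro mult_right_mono power_mono)
      moreover have "0 \<le> a^3" using nn by simp
      ultimately show ?thesis by (simp add: power2_eq_square power3_eq_cube)
    next
      case False
      then have "a\<^sup>2 * c \<le> a\<^sup>2 * a" by (intro mult_left_mono) auto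
      moreover have "0 \<le> c^3" using nn by simp
      ultimately show ?thesis by (simp add: power2_eq_square power3_eq_cube)
    qed
    ultimately have *: "0 \<le> a^3 - a * b\<^sup>2 - 2 * a * b * c + 2 * a\<^sup>2 * b + 8 * b\<^sup>2 * c
        + (a^3 + b^3 + c^3) * (1/8) - a^3"
      by (simp add: power2_eq_square power3_eq_cube algebra_simps)
    have "0 \<le> kcoef n * (a^3 - a * b\<^sup>2 - 2 * a * b * c + 2 * a\<^sup>2 * b + 8 * b\<^sup>2 * c
        + (a^3 + b^3 + c^3) * (1/8) - a^3)"
      by (intro mult_nonneg_nonneg *) (simp add: kcoef_def)
    moreover have "0 \<le> kcoef (n-1) * (X (n-1) x)\<^sup>2 * b"
      using nn by (simp add: kcoef_def)
    moreover have "kcoef (n+1) = 2 * kcoef n" by (simp add: kcoef_def)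
    ultimately show ?thesis
      unfolding H'_def a_def[symmetric] b_def[symmetric] c_def[symmetric]
      by (simp add: power2_eq_square power3_eq_cube algebra_simps)
  qed
  have main: "kcoef n * J n \<le> (H t - H s) + kcoef n * ((J n + J (n+1) + J (n+2)) * (1/8))"
    using has_integral_mult_right[OF I]
  proof (rule has_integral_le[OF _ _ pointwise])
    show "((\<lambda>x. H' x + kcoef n * (((X n x)^3 + (X (n+1) x)^3 + (X (n+2) x)^3) * (1/8)))
        has_integral (H t - H s) + kcoef n * ((J n + J (n+1) + J (n+2)) * (1/8))) {s..t}"
      by (intro has_integral_mult_right has_integral_mult_left has_integral_add FTC I)
  qed
  \<comment> \<open>The product at time t is at most half of \<open>energy (n+1) t\<close>, so
    \<open>H t\<close> <= 0. Moreover \<open>- H s\<close> is at most E_n(s) + 2 E_{n+1}(s) <= (1 +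
    5/2) A (5/4)^n, and 5 is a rounded constant.\<close>
  have "H t - H s \<le> 5 * A * (5/4)^n"
  proof -
    have "0 \<le> t" using assms by simp
    have "2 * (X n t * X (n+1) t) \<le> (X n t)\<^sup>2 + (X (n+1) t)\<^sup>2"
      using sum_squares_bound[of "X n t" "X (n+1) t"] by simp
    also have "\<dots> \<le> energy n t + (X (n+1) t)\<^sup>2" using square_le_energy[of n t] assms by simp
    also have "\<dots> = energy (n+1) t" by (simp add: energy_def)
    finally have 1: "2 * (X n t * X (n+1) t) \<le> energy (n+1) t" .
    have 2: "energy (n+1) t \<le> energy (n+1) s" using assms by (intro energy_antimono)
    have 3: "0 \<le> X n s * X (n+1) s" "0 \<le> energy n t" "0 \<le> energy (n+1) t"
      using nonneg[OF \<open>0 \<le> s\<close>] by (simp_all add: energy_nonneg)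
    have 4: "0 \<le> energy n s" by (rule energy_nonneg)
    have 5: "energy n s \<le> A * (5/4)^n" "energy (n+1) s \<le> A * (5/4)^n * (5/4)"
      using A[of n] A[of "n+1"] by auto
    show ?thesis using 1 2 3 4 5 unfolding H_def by linarith
  qed
  \<comment> \<open>After multiplication by 8, one copy of \<open>J n\<close> moves to the left.
    Division by 2^n then produces the ratio 5/8, and 40/7 <= 6 gives the constant.\<close>
  with main have "kcoef n * (J n * 7 - (J (n+1) + J (n+2))) \<le> 40 * A * (5/4)^n"
    by (simp add: algebra_simps)
  also have "\<dots> = kcoef n * (40 * A * (5/8)^n)"
    by (simp add: kcoef_def power_mult_distrib[symmetric])
  finally have "J n * 7 - (J (n+1) + J (n+2)) \<le> 40 * A * (5/8)^n"
    by (simp add: kcoef_def)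
  \<comment> \<open>At index 0 the energy is an empty sum, so the hypothesis on \<open>A\<close>
    forces \<open>A\<close> to be nonnegative.\<close>
  moreover have "0 \<le> A * (5/8)^n"
    using A[of 0] by (auto simp: energy_def)
  ultimately show ?thesis by (simp add: field_simps)
qed

text \<open>Solves the recursion. The crude \<open>growth\<close> bound depends on t - s but only
  feeds the iteration, so the result does not depend on the length of the interval.\<close>

lemma cube_integral_le:
  assumes "0 \<le> s" "s \<le> t" "1 \<le> n" and A: "\<And>n. energy n s \<le> A * (5/4)^n"
  shows "integral {s..t} (\<lambda>x. (X n x)^3) \<le> 12 * A * (5/8)^n"
proof -
  have "0 \<le> A" using A[of 0] by (auto simp: energy_def)
  have growth: "integral {s..t} (\<lambda>x. (X n x)^3) \<le> (t - s) * (A * (1 + A)) * (25/16)^n" 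
    if "1 \<le> n" for n
  proof -
    define b :: real where "b = (5/4)^n"
    have "1 \<le> b" by (simp add: b_def)
    have "(X n x)^3 \<le> A * (1 + A) * (25/16)^n" if "x \<in> {s..t}" for x
    proof -
      have "0 \<le> x" using that assms by auto
      have "(X n x)\<^sup>2 \<le> energy n x" using square_le_energy \<open>1 \<le> n\<close> .
      also have "\<dots> \<le> energy n s" using that assms by (intro energy_antimono) auto
      also have "\<dots> \<le> A * b" using A by (simp add: b_def)
      finally have *: "(X n x)\<^sup>2 \<le> A * b" .
      \<comment> \<open>This avoids square roots: the cube is then bounded by b^2 instead of
        b^(3/2), and b^2 = (25/16)^n is still a growth that the recursion tolerates.\<close>
      have "2 * X n x \<le> 1 + (X n x)\<^sup>2" using sum_squares_bound[of 1 "X n x"] by simp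
      then have "X n x \<le> 1 + (X n x)\<^sup>2" using nonneg[OF \<open>0 \<le> x\<close>, of n] by linarith
      also have "\<dots> \<le> b + A * b" using * \<open>1 \<le> b\<close> by simp
      finally have "(X n x)\<^sup>2 * X n x \<le> (A * b) * (b + A * b)"
        using * nonneg[OF \<open>0 \<le> x\<close>, of n] \<open>0 \<le> A\<close> \<open>1 \<le> b\<close> by (intro mult_mono) auto
      also have "\<dots> = A * (1 + A) * b\<^sup>2" by (simp add: power2_eq_square algebra_simps)
      also have "b\<^sup>2 = (25/16)^n" by (simp add: b_def power2_eq_square power_mult_distrib[symmetric])
      finally show ?thesis by (simp add: power2_eq_square power3_eq_cube)
    qed
    then have "integral {s..t} (\<lambda>x. (X n x)^3) \<le> integral {s..t} (\<lambda>x. A * (1 + A) * (25/16)^n)"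
      using assms by (intro integral_le integrable_cube) auto
    then show ?thesis using \<open>s \<le> t\<close> by (simp add: algebra_simps)
  qed
  show ?thesis
    using le_geometric_of_recursion[of "\<lambda>n. integral {s..t} (\<lambda>x. (X n x)^3)" "6 * A", OF _ growth]
      cube_integral_rec[OF \<open>0 \<le> s\<close> \<open>s \<le> t\<close> _ A] \<open>0 \<le> A\<close> assms
    by auto
qed

section \<open>Decay of the energy, uniformly in the truncation\<close>

text \<open>By monotonicity the left side is at most the integral of \<open>energy N\<close> over
  {s..s+T}. Replacing squares by cubes componentwise leaves two convergent geometric series, hence a
  bound free of N.\<close>

lemma energy_decay:
  assumes "0 \<le> s" "0 < T" "0 < \<theta>" and A: "\<And>n. energy n s \<le> A * (5/4)^n"
  shows "T * energy N (s + T) \<le> 29 * A / \<theta> + T * \<theta>\<^sup>2"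
proof -
  have "0 \<le> A" using A[of 0] by (auto simp: energy_def)
  \<comment> \<open>Young's inequality with weight $r_j$; the ratio $4/5$ keeps both $(5/8)/(4/5)$ and $(4/5)^2$ below 1.\<close>
  define r where "r = (\<lambda>j::nat. \<theta> * (4/5)^j)"
  have r: "0 < r j" for j using assms by (simp add: r_def)
  define J where "J = (\<lambda>n. integral {s..s+T} (\<lambda>x. (X n x)^3))"
  have I: "((\<lambda>x. (X m x)^3) has_integral J m) {s..s+T}" for m
    unfolding J_def using integrable_cube[OF \<open>0 \<le> s\<close>] by (rule integrable_integral)
  have const: "((\<lambda>x. c) has_integral T * c) {s..s+T}" for c :: real
    using has_integral_const_real[of c s "s+T"] \<open>0 < T\<close> by simp
  have upper: "((\<lambda>x. \<Sum>j=1..N. (2/3 / r j) * (X j x)^3 + (r j)\<^sup>2 / 3)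
      has_integral (\<Sum>j=1..N. (2/3 / r j) * J j + T * ((r j)\<^sup>2 / 3))) {s..s+T}"
    by (intro has_integral_sum has_integral_add has_integral_mult_right I const) auto
  have lower: "((\<lambda>x. energy N (s+T)) has_integral T * energy N (s+T)) {s..s+T}"
    by (rule const)
  have le: "energy N (s+T) \<le> (\<Sum>j=1..N. (2/3 / r j) * (X j x)^3 + (r j)\<^sup>2 / 3)"
    if "x \<in> {s..s+T}" for x
  proof -
    have "energy N (s+T) \<le> energy N x" using that assms by (intro energy_antimono) auto
    also have "\<dots> \<le> (\<Sum>j=1..N. (2/3 / r j) * (X j x)^3 + (r j)\<^sup>2 / 3)"
      unfolding energy_def
    proof (rule sum_mono)
      fix j
      show "(X j x)\<^sup>2 \<le> (2/3 / r j) * (X j x)^3 + (r j)\<^sup>2 / 3"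
        using square_le_cube[OF nonneg r, of x j j] that assms by simp
    qed
    finally show ?thesis .
  qed
  have "T * energy N (s+T) \<le> (\<Sum>j=1..N. (2/3 / r j) * J j + T * ((r j)\<^sup>2 / 3))"
    using lower upper le by (rule has_integral_le)
  also have "\<dots> \<le> (\<Sum>j=1..N. 8 * A / \<theta> * (25/32)^j + T * \<theta>\<^sup>2 / 3 * (16/25)^j)"
  proof (rule sum_mono)
    fix j assume "j \<in> {1..N}"
    then have "J j \<le> 12 * A * (5/8)^j"
      unfolding J_def using assms by (intro cube_integral_le) auto
    then have "(2/3 / r j) * J j \<le> (2/3 / r j) * (12 * A * (5/8)^j)"
      using r[of j] by (intro mult_left_mono) auto
    also have "\<dots> = 8 * A / \<theta> * ((5/8)^j / (4/5)^j)" by (simp add: r_def)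
    also have "((5/8)^j / (4/5)^j) = (25/32::real)^j" by (simp add: power_divide[symmetric])
    finally have 1: "(2/3 / r j) * J j \<le> 8 * A / \<theta> * (25/32)^j" .
    have "(r j)\<^sup>2 = \<theta>\<^sup>2 * ((4/5)^j * (4/5)^j)" by (simp add: r_def power2_eq_square)
    also have "(4/5)^j * (4/5)^j = (16/25::real)^j" by (simp add: power_mult_distrib[symmetric])
    finally have 2: "(r j)\<^sup>2 = \<theta>\<^sup>2 * (16/25)^j" .
    show "(2/3 / r j) * J j + T * ((r j)\<^sup>2 / 3) \<le> 8 * A / \<theta> * (25/32)^j + T * \<theta>\<^sup>2 / 3 * (16/25)^j"
      using 1 2 by simp
  qed
  also have "\<dots> = 8 * A / \<theta> * (\<Sum>j=1..N. (25/32)^j) + T * \<theta>\<^sup>2 / 3 * (\<Sum>j=1..N. (16/25)^j)"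
    by (simp add: sum.distrib sum_distrib_left)
  \<comment> \<open>The two series sum to at most 25/7 <= 29/8 and 16/9 <= 3.\<close>
  also have "\<dots> \<le> 8 * A / \<theta> * (29/8) + T * \<theta>\<^sup>2 / 3 * 3"
    using sum_power_le[of "25/32" N] sum_power_le[of "16/25" N] \<open>0 \<le> A\<close> assms
    by (intro add_mono mult_left_mono) auto
  finally show ?thesis by simp
qed

lemma energy_inverse_square:
  assumes M: "\<And>n. 1 \<le> n \<Longrightarrow> X n 0 \<le> M"
  obtains K where "0 < K" "\<And>N t. 1 \<le> t \<Longrightarrow> energy N t \<le> K / t\<^sup>2"
proof -
  have "energy n 0 \<le> 4 * M\<^sup>2 * (5/4)^n" for n
  proof -
    have "energy n 0 \<le> (\<Sum>j=1..n. M\<^sup>2)"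
      unfolding energy_def using M nonneg[of 0] by (intro sum_mono power_mono) auto
    also have "\<dots> = M\<^sup>2 * real n" by simp
    also have "real n \<le> 4 * (5/4)^n" using Bernoulli_inequality[of "1/4::real" n] by simp
    finally show ?thesis by (simp add: mult_left_mono mult.left_commute)
  qed
  then have 1: "energy N 1 \<le> 29 * (4 * M\<^sup>2) + 1" for N
    using energy_decay[of 0 1 1 "4 * M\<^sup>2" N] by simp
  \<comment> \<open>With $\theta = 232/s$ the decay estimate gives $s^2 E_N(2s) \le K/8 + 232^2$, which must be at most $K/4$.\<close>
  define K where "K = 4 * (29 * (4 * M\<^sup>2) + 1) + 8 * 232\<^sup>2"
  have K: "4 * (29 * (4 * M\<^sup>2) + 1) \<le> K" "8 * 232\<^sup>2 \<le> K" "0 < K"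
    by (auto simp: K_def intro: add_pos_nonneg)
  \<comment> \<open>All N are carried through the induction together, because the estimate for one N
    at time t uses the energies of every index at time t/2.\<close>
  have "\<forall>N. energy N t \<le> K / t\<^sup>2" if "1 \<le> t" "t \<le> 2 ^ Suc m" for t m
    using that
  proof (induction m arbitrary: t)
    case 0
    \<comment> \<open>On [1, 2] the energy is at most its value at time 1 and t^2 <= 4; the first
      summand of \<open>K\<close> is chosen for this.\<close>
    have "energy N t * t\<^sup>2 \<le> (29 * (4 * M\<^sup>2) + 1) * 2\<^sup>2" for N
      using 0 1[of N] energy_antimono[of 1 t N] by (intro mult_mono power_mono) auto
    also have "\<dots> \<le> K" using K by simp
    finally show ?case using 0 by (simp add: field_simps)
  next
    case (Suc m)
    show ?case
    proof (cases "t \<le> 2")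
      case True
      have "energy N t * t\<^sup>2 \<le> (29 * (4 * M\<^sup>2) + 1) * 2\<^sup>2" for N
        using Suc.prems True 1[of N] energy_antimono[of 1 t N] by (intro mult_mono power_mono) auto
      also have "\<dots> \<le> K" using K by simp
      finally show ?thesis using Suc.prems by (simp add: field_simps)
    next
      case False
      define s where "s = t / 2"
      have s: "1 \<le> s" "s \<le> 2 ^ Suc m" "t = s + s" using False Suc.prems by (auto simp: s_def)
      have A: "energy n s \<le> K / s\<^sup>2 * (5/4)^n" for n
      proof -
        have "energy n s \<le> K / s\<^sup>2 * 1" using Suc.IH[OF s(1,2)] by simp
        also have "\<dots> \<le> K / s\<^sup>2 * (5/4)^n" using K by (intro mult_left_mono) auto
        finally show ?thesis .
      qed
      have "energy N t \<le> K / t\<^sup>2" for N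
      proof -
        have "s * energy N t \<le> 29 * (K / s\<^sup>2) / (232 / s) + s * (232 / s)\<^sup>2"
          using energy_decay[OF _ _ _ A, of s "232 / s" N] s by simp
        then have "s * energy N t * s \<le> (29 * (K / s\<^sup>2) / (232 / s) + s * (232 / s)\<^sup>2) * s"
          using s by (intro mult_right_mono) auto
        also have "\<dots> = K / 8 + 232\<^sup>2"
          using s by (simp add: field_simps power2_eq_square)
        also have "\<dots> \<le> K / 4" using K by simp
        finally show ?thesis using s by (simp add: field_simps power2_eq_square)
      qed
      then show ?thesis by simp
    qed
  qed
  moreover have "\<exists>m. t \<le> 2 ^ Suc m" for t :: real
  proof -
    obtain m where "t < 2 ^ m" using real_arch_pow[of 2 t] by auto
    then have "t \<le> 2 ^ Suc m" by (simp, smt (verit) zero_less_power)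
    then show ?thesis by blast
  qed
  ultimately show thesis using that K(3) by blast
qed

section \<open>Integrating factor and strict positivity\<close>

text \<open>The exponential is the integrating factor of the loss term: the derivative of the
  product with it is the production term times the exponential, hence nonnegative.\<close>

lemma exp_lower_bound:
  assumes "0 \<le> s" "s \<le> t" "1 \<le> n"
  shows "X n s \<le> X n t * exp (kcoef n * integral {s..t} (X (n + 1)))"
proof -
  define P where "P = (\<lambda>x. integral {s..x} (X (n+1)))"
  have "X n s * exp (kcoef n * P s) \<le> X n t * exp (kcoef n * P t)"
  proof (rule increasing_within[where f = "\<lambda>x. X n x * exp (kcoef n * P x)"])
    fix x assume x: "x \<in> {s..t}"
    then have "0 \<le> x" using assms by simp
    have "(P has_real_derivative X (n+1) x) (at x within {s..t})"
      unfolding P_def using x assms by (intro integral_has_real_derivative continuous) auto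
    moreover have "(X n has_real_derivative
        kcoef (n - 1) * (X (n - 1) x)\<^sup>2 - kcoef n * X n x * X (n + 1) x) (at x within {s..t})"
      using deriv[OF \<open>1 \<le> n\<close> \<open>0 \<le> x\<close>] by (rule DERIV_subset) (use assms in auto)
    ultimately show "((\<lambda>x. X n x * exp (kcoef n * P x)) has_real_derivative
        kcoef (n - 1) * (X (n - 1) x)\<^sup>2 * exp (kcoef n * P x)) (at x within {s..t})"
      by (auto intro!: derivative_eq_intros simp: algebra_simps)
    show "0 \<le> kcoef (n - 1) * (X (n - 1) x)\<^sup>2 * exp (kcoef n * P x)"
      by (simp add: kcoef_def)
  qed (use assms in auto)
  then show ?thesis by (simp add: P_def)
qed

lemma pos_of_pos_before:
  assumes "0 \<le> s" "s \<le> t" "1 \<le> n" "0 < X n s"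
  shows "0 < X n t"
  using exp_lower_bound[OF assms(1-3)] assms(4) by (smt (verit) exp_gt_zero mult_nonpos_nonneg)

text \<open>A zero at a time t > 0 would be an interior minimum of a nonnegative function, so the
  derivative would vanish there; but the equation gives the derivative
  \<open>kcoef n * (X n t)\<^sup>2\<close>, which is positive.\<close>

lemma pos_step:
  assumes "\<And>t. 0 < t \<Longrightarrow> 0 < X n t" "1 \<le> n" "0 < t"
  shows "0 < X (n + 1) t"
proof (rule ccontr)
  assume "\<not> 0 < X (n + 1) t"
  then have z: "X (n + 1) t = 0" using nonneg[of t "n+1"] assms by simp
  have "(X (n+1) has_real_derivative kcoef n * (X n t)\<^sup>2) (at t within {0..})"
    using deriv[of "n+1" t] assms z by simp
  moreover have "at t within {0..} = at t"
    using assms by (intro at_within_interior) simp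
  ultimately have "(X (n+1) has_real_derivative kcoef n * (X n t)\<^sup>2) (at t)" by simp
  then have "kcoef n * (X n t)\<^sup>2 = 0"
    \<comment> \<open>The radius t keeps the neighbourhood inside positive times, where
      \<open>nonneg\<close> applies.\<close>
    by (rule DERIV_local_min[of _ _ _ t]) (use assms z nonneg in auto)
  then show False using assms(1)[OF assms(3)] by (simp add: kcoef_def)
qed

text \<open>Component n0 + 1 stays positive by the integrating factor. Positivity then passes
  instantly to each higher component, even from initial value 0.\<close>

lemma pos_after:
  assumes "0 < X (n0 + 1) 0" "n0 < n" "0 < t"
  shows "0 < X n t"
proof -
  have "\<forall>t>0. 0 < X n t" if "n0 + 1 \<le> n"
    using that
  proof (induction n rule: dec_induct)
    case base
    then show ?case using pos_of_pos_before[of 0 _ "n0+1"] assms(1) by auto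
  next
    case (step n)
    then show ?case using pos_step[of n] by auto
  qed
  then show ?thesis using assms by simp
qed

end

section \<open>Passage from componentwise solutions to the locale\<close>

lemma dyadic_positive_of_solution:
  assumes "componentwise_solution X0 X" "positive_solution X"
  shows "dyadic_positive X"
proof
  show z: "X 0 t = 0" if "0 \<le> t" for t
    using assms(1) that by (simp add: componentwise_solution_def)
  show "(X n has_real_derivative kcoef (n - 1) * (X (n - 1) t)\<^sup>2 - kcoef n * X n t * X (n + 1) t)
      (at t within {0..})" if "1 \<le> n" "0 \<le> t" for n t
    using assms(1) that unfolding componentwise_solution_def by metis
  show "0 \<le> X n t" if "0 \<le> t" for n t
    using assms(2) that z[OF that] unfolding positive_solution_def by (cases "n = 0") auto
qed

section \<open>Consequences of logarithmic growth of an integral\<close>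

lemma infinite_integral_of_log_lower_bound:
  fixes f :: "real \<Rightarrow> real"
  assumes cont: "\<And>t. continuous_on {1..t} f" and nonneg: "\<And>t. 1 \<le> t \<Longrightarrow> 0 \<le> f t"
    and "0 < k" and bound: "\<And>t. 1 \<le> t \<Longrightarrow> k * ln t + c \<le> integral {1..t} f"
  shows "(\<integral>\<^sup>+s\<in>{1..}. ennreal (f s) \<partial>lborel) = \<infinity>"
proof (rule ccontr)
  let ?I = "\<integral>\<^sup>+s\<in>{1..}. ennreal (f s) \<partial>lborel"
  assume "?I \<noteq> \<infinity>"
  then obtain r where r: "?I = ennreal r" "0 \<le> r" by (cases ?I) auto
  have le: "k * ln t + c \<le> r" if "1 \<le> t" for t
  proof -
    have si: "set_integrable lborel {1..t} f"
      using cont by (intro borel_integrable_atLeastAtMost') auto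
    have "ennreal (integral {1..t} f) = ennreal (LINT s:{1..t}|lborel. f s)"
      using set_borel_integral_eq_integral[OF si] by simp
    also have "\<dots> = (\<integral>\<^sup>+s\<in>{1..t}. ennreal (f s) \<partial>lborel)"
    proof -
      have "(\<integral>\<^sup>+s. ennreal (indicator {1..t} s * f s) \<partial>lborel) = ennreal (LINT s:{1..t}|lborel. f s)"
        unfolding set_lebesgue_integral_def real_scaleR_def
        using si nonneg unfolding set_integrable_def
        by (intro nn_integral_eq_integral) (auto simp: indicator_def)
      moreover have "ennreal (indicator {1..t} s * f s) = ennreal (f s) * indicator {1..t} s" for s
        by (auto simp: indicator_def)
      ultimately show ?thesis by simp
    qed
    also have "\<dots> \<le> ?I" by (intro nn_integral_mono) (auto simp: indicator_def)
    finally have "ennreal (integral {1..t} f) \<le> ennreal r" using r by simp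
    then have "integral {1..t} f \<le> r" using r(2) by simp
    then show ?thesis using bound[OF that] by simp
  qed
  \<comment> \<open>Chosen so that k ln t exceeds r - c, which contradicts
    \<open>le\<close>.\<close>
  define t where "t = exp ((\<bar>r\<bar> + \<bar>c\<bar> + 1) / k)"
  have "1 \<le> t" using \<open>0 < k\<close> by (simp add: t_def)
  moreover have "k * ln t = \<bar>r\<bar> + \<bar>c\<bar> + 1" using \<open>0 < k\<close> by (simp add: t_def)
  ultimately show False using le[of t] by simp
qed

text \<open>If the limsup were below some q < k, then f(s) < q/s eventually, and the integral would
  grow at most like q ln t, too slowly for the lower bound.\<close>

lemma Limsup_of_log_lower_bound:
  fixes f :: "real \<Rightarrow> real"
  assumes cont: "\<And>t. continuous_on {1..t} f"
    and bound: "\<And>t. 1 \<le> t \<Longrightarrow> k * ln t + c \<le> integral {1..t} f"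
  shows "ereal k \<le> Limsup at_top (\<lambda>t. ereal (t * f t))"
proof (rule ccontr)
  assume "\<not> ?thesis"
  then obtain q where q: "Limsup at_top (\<lambda>t. ereal (t * f t)) < ereal q" "ereal q < ereal k"
    using ereal_dense2[of _ "ereal k"] by (auto simp: not_le)
  then have "\<forall>\<^sub>F t in at_top. t * f t < q" using Limsup_lessD[OF q(1)] by simp
  then obtain t1 where t1: "\<And>t. t1 \<le> t \<Longrightarrow> t * f t < q"
    by (auto simp: eventually_at_top_linorder)
  define t0 where "t0 = max t1 1"
  have t0: "1 \<le> t0" "t1 \<le> t0" by (auto simp: t0_def)
  define d where "d = integral {1..t0} f - q * ln t0"
  have up: "integral {1..t} f \<le> q * ln t + d" if "t0 \<le> t" for t
  proof -
    have int: "f integrable_on {1..t}" using cont by (rule integrable_continuous_real)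
    then have int2: "f integrable_on {t0..t}"
      by (rule integrable_on_subinterval) (use t0 in auto)
    have "((\<lambda>s. q / s) has_integral q * ln t - q * ln t0) {t0..t}"
    proof (rule fundamental_theorem_of_calculus[OF that])
      fix x assume "x \<in> {t0..t}"
      then have "((\<lambda>s. q * ln s) has_real_derivative q / x) (at x within {t0..t})"
        using t0 by (auto intro!: derivative_eq_intros)
      then show "((\<lambda>s. q * ln s) has_vector_derivative q / x) (at x within {t0..t})"
        by (simp add: has_real_derivative_iff_has_vector_derivative)
    qed
    with integrable_integral[OF int2] have "integral {t0..t} f \<le> q * ln t - q * ln t0"
    proof (rule has_integral_le)
      fix s assume "s \<in> {t0..t}"
      then show "f s \<le> q / s" using t1[of s] t0 by (simp add: field_simps)
    qed
    moreover have "integral {1..t0} f + integral {t0..t} f = integral {1..t} f"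
      using int that t0 by (intro Henstock_Kurzweil_Integration.integral_combine) auto
    ultimately show ?thesis by (simp add: d_def)
  qed
  have "0 < k - q" using q by simp
  \<comment> \<open>Large enough that (k - q) ln t exceeds d - c, while \<open>up\<close> still
    applies.\<close>
  define t where "t = max t0 (exp ((\<bar>d\<bar> + \<bar>c\<bar> + 1) / (k - q)))"
  have t: "t0 \<le> t" "1 \<le> t" using t0 by (auto simp: t_def)
  have "(\<bar>d\<bar> + \<bar>c\<bar> + 1) / (k - q) \<le> ln t"
    using t by (subst ln_ge_iff) (auto simp: t_def)
  then have "\<bar>d\<bar> + \<bar>c\<bar> + 1 \<le> (k - q) * ln t" using \<open>0 < k - q\<close> by (simp add: field_simps)
  moreover have "k * ln t + c \<le> q * ln t + d" using up[OF t(1)] bound[OF t(2)] by simp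
  ultimately show False by (simp add: algebra_simps)
qed

section \<open>Assembly: decay, positivity and the logarithmic bound\<close>

theorem theorem9:
  fixes X :: "nat \<Rightarrow> real \<Rightarrow> real" and X0 :: "nat \<Rightarrow> real" and n0 :: nat
  assumes "componentwise_solution X0 X"
    and "positive_solution X"
    and "X0 \<in> bounded_seqs \<inter> nonneg_seqs"
    and "X0 (n0 + 1) > 0"
    and "\<And>m. m \<ge> 1 \<Longrightarrow> X0 m > 0 \<Longrightarrow> n0 + 1 \<le> m"
  shows "(\<forall>n>n0. \<forall>t>0. X n t > 0) \<and>
    (\<exists>C>0. \<forall>n>n0. \<forall>t\<ge>1.
      integral {1..t} (X (n + 1)) \<ge>
        inverse (kcoef n) * ln t + inverse (kcoef n) * ln (X n 1 / C)) \<and>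
    (\<forall>n>n0. (\<integral>\<^sup>+s\<in>{1..}. ennreal (X (n + 1) s) \<partial>lborel) = \<infinity>) \<and>
    (\<forall>n>n0. Limsup at_top (\<lambda>t. ereal (t * X (n + 1) t)) \<ge> ereal (inverse (kcoef n)))"
proof -
  interpret dyadic_positive X using assms(1,2) by (rule dyadic_positive_of_solution)
  have init: "X n 0 = X0 n" if "1 \<le> n" for n
    using assms(1) that by (simp add: componentwise_solution_def)
  obtain M where "\<forall>x \<in> X0 ` {1..}. norm x \<le> M"
    using assms(3) by (auto simp: bounded_seqs_def bounded_iff)
  then have "X n 0 \<le> M" if "1 \<le> n" for n
    using that init by force
  then obtain K where "0 < K" and K: "\<And>N t. 1 \<le> t \<Longrightarrow> energy N t \<le> K / t\<^sup>2"
    using energy_inverse_square by blast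
  \<comment> \<open>One constant serves all n because \<open>K\<close> bounds the energies of every
    truncation.\<close>
  define C where "C = sqrt K"
  have "0 < C" using \<open>0 < K\<close> by (simp add: C_def)
  have decay: "X n t \<le> C / t" if "1 \<le> n" "1 \<le> t" for n t
  proof -
    have "(X n t)\<^sup>2 \<le> K / t\<^sup>2" using square_le_energy[OF that(1)] K[OF that(2)] by (rule order_trans)
    also have "\<dots> = (C / t)\<^sup>2" using \<open>0 < K\<close> by (simp add: C_def power_divide)
    finally show ?thesis using \<open>0 < C\<close> that by (auto intro: power2_le_imp_le)
  qed
  have pos: "0 < X n t" if "n0 < n" "0 < t" for n t
    using pos_after[OF _ that] assms(4) init by simp
  have log_bound: "inverse (kcoef n) * ln t + inverse (kcoef n) * ln (X n 1 / C)
      \<le> integral {1..t} (X (n + 1))" if "n0 < n" "1 \<le> t" for n t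
  proof -
    let ?e = "exp (kcoef n * integral {1..t} (X (n + 1)))"
    have k: "0 < kcoef n" by (simp add: kcoef_def)
    have "X n 1 \<le> X n t * ?e" using that by (intro exp_lower_bound) auto
    also have "\<dots> \<le> C / t * ?e" using decay that by (intro mult_right_mono) auto
    finally have "t * (X n 1 / C) \<le> ?e" using \<open>0 < C\<close> that by (simp add: field_simps)
    \<comment> \<open>Strict positivity of \<open>X n 1\<close> enters here: it makes the argument
      of the logarithm positive.\<close>
    then have "ln (t * (X n 1 / C)) \<le> ln ?e"
      using pos[of n 1] \<open>0 < C\<close> that by (intro ln_mono) auto
    then have "ln (t * (X n 1 / C)) \<le> kcoef n * integral {1..t} (X (n + 1))"
      by simp
    also have "ln (t * (X n 1 / C)) = ln t + ln (X n 1 / C)"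
      using pos[of n 1] \<open>0 < C\<close> that by (intro ln_mult_pos) auto
    finally show ?thesis using k by (simp add: field_simps)
  qed
  have "(\<integral>\<^sup>+s\<in>{1..}. ennreal (X (n + 1) s) \<partial>lborel) = \<infinity>" if "n0 < n" for n
    using infinite_integral_of_log_lower_bound[OF continuous nonneg _ log_bound[OF that]]
    by (simp add: kcoef_def)
  moreover have "ereal (inverse (kcoef n)) \<le> Limsup at_top (\<lambda>t. ereal (t * X (n + 1) t))"
    if "n0 < n" for n
    using Limsup_of_log_lower_bound[OF continuous log_bound[OF that]] by simp
  ultimately show ?thesis using pos log_bound \<open>0 < C\<close> by blast
qed

end
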